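(* Let $1 \to A \to G \to B \to 1$ be a short exact sequence of groups such that: (1) $A$ is residually nilpotent, i.e. $\gamma_\omega(A)=1$; (2) $B$ is nilpotent, i.e. $\gamma_s(B)=1$ for some $s\ge 2$; (3) there exists a natural number $N\ge 1$ such that $\Delta_B^N\,\overline{A}=0$, where $\overline{A}=A/\gamma_2(A)$. Then $G$ is residually nilpotent.
   Context: $\gamma_1(G)=G$, $\gamma_{k+1}(G)=[\gamma_k(G),G]$, and $\gamma_\omega(G)=\bigcap_{k\ge1}\gamma_k(G)$. A group is residually nilpotent if every non-identity element survives in some nilpotent quotient; equivalently $\gamma_\omega(G)=1$. In an extension $1\to A\to G\to B\to 1$, $A$ is regarded as a normal subgroup of $G$ with $G/A\cong B$; conjugation by elements of $G$ on $\overline{A}=A/\gamma_2(A)$ is trivial for elements of $A$ and so induces an action of $B$ on $\overline{A}$, making $\overline{A}$ (written additively) a $\mathbb{Z}[B]$-module. $\Delta_B=\ker(\mathbb{Z}[B]\to\mathbb{Z})$ is the augmentation ideal and $\Delta_B^N$ its $N$-th power. *)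

theory Defs
  imports "HOL-Algebra.Algebra"
begin

section \<open>Lower central series\<close>

definition commutator_subgroup :: "('a, 'm) monoid_scheme \<Rightarrow> 'a set \<Rightarrow> 'a set \<Rightarrow> 'a set"
  where "commutator_subgroup G H K =
    generate G (\<Union>h\<in>H. \<Union>k\<in>K. {h \<otimes>\<^bsub>G\<^esub> k \<otimes>\<^bsub>G\<^esub> inv\<^bsub>G\<^esub> h \<otimes>\<^bsub>G\<^esub> inv\<^bsub>G\<^esub> k})"

text \<open>Indexed from 1, so that \<open>lower_central G 1 = carrier G\<close>; the index 0 is not meaningful
  (truncated subtraction makes \<open>lower_central G 0 = carrier G\<close>).\<close>

definition lower_central :: "('a, 'm) monoid_scheme \<Rightarrow> nat \<Rightarrow> 'a set"
  where "lower_central G k = ((\<lambda>H. commutator_subgroup G H (carrier G)) ^^ (k - 1)) (carrier G)"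

definition lower_central_omega :: "('a, 'm) monoid_scheme \<Rightarrow> 'a set"
  where "lower_central_omega G = (\<Inter>k\<in>{1..}. lower_central G k)"

definition nilpotent_group :: "('a, 'm) monoid_scheme \<Rightarrow> bool"
  where "nilpotent_group G \<longleftrightarrow> group G \<and> (\<exists>s\<ge>2. lower_central G s = {\<one>\<^bsub>G\<^esub>})"

definition residually_nilpotent :: "('a, 'm) monoid_scheme \<Rightarrow> bool"
  where "residually_nilpotent G \<longleftrightarrow> group G \<and>
    (\<forall>x\<in>carrier G - {\<one>\<^bsub>G\<^esub>}. \<exists>N. N \<lhd> G \<and> nilpotent_group (G Mod N) \<and> N #>\<^bsub>G\<^esub> x \<noteq> \<one>\<^bsub>G Mod N\<^esub>)"

lemma lower_central_1 [simp]: "lower_central G (Suc 0) = carrier G"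
  by (simp add: lower_central_def)

lemma lower_central_Suc:
  "k \<ge> 1 \<Longrightarrow> lower_central G (Suc k) = commutator_subgroup G (lower_central G k) (carrier G)"
  by (cases k) (simp_all add: lower_central_def)

lemma lower_central_2: "lower_central G 2 = derived G (carrier G)"
  by (simp add: numeral_2_eq_2 lower_central_Suc commutator_subgroup_def derived_def)

lemma (in group) commutator_subgroup_normal:
  assumes "H \<lhd> G" shows "commutator_subgroup G H (carrier G) \<lhd> G"
proof -
  interpret H: normal H G by fact
  let ?S = "\<Union>h\<in>H. \<Union>k\<in>carrier G. {h \<otimes> k \<otimes> inv h \<otimes> inv k}"
  have "g \<otimes> s \<otimes> inv g \<in> ?S" if s: "s \<in> ?S" and g: "g \<in> carrier G" for s g
  proof -
    obtain h k where hk: "h \<in> H" "k \<in> carrier G" "s = h \<otimes> k \<otimes> inv h \<otimes> inv k"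
      using s by auto
    have h: "h \<in> carrier G" using hk(1) by simp
    define h' where "h' = g \<otimes> h \<otimes> inv g"
    define k' where "k' = g \<otimes> k \<otimes> inv g"
    have cancel: "inv g \<otimes> (g \<otimes> z) = z" if "z \<in> carrier G" for z
      using that g by (simp flip: m_assoc)
    have "g \<otimes> s \<otimes> inv g = h' \<otimes> k' \<otimes> inv h' \<otimes> inv k'"
      unfolding h'_def k'_def hk(3) using g h hk(2)
      by (simp add: inv_mult_group m_assoc cancel)
    moreover have "h' \<in> H" "k' \<in> carrier G"
      using hk g by (auto simp: h'_def k'_def H.inv_op_closed2)
    ultimately show ?thesis by blast
  qed
  moreover have "?S \<subseteq> carrier G" by (auto simp: H.mem_carrier)
  ultimately show ?thesis
    unfolding commutator_subgroup_def by (intro normal_generateI)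
qed

lemma (in group) lower_central_normal: "lower_central G k \<lhd> G"
proof -
  have "lower_central G (Suc n) \<lhd> G" for n
  proof (induction n)
    case 0
    show ?case by (simp add: normal_inv_iff subgroup_self)
  next
    case (Suc n)
    then show ?case by (simp add: lower_central_Suc commutator_subgroup_normal)
  qed
  then show ?thesis by (metis lower_central_def diff_Suc_1 lower_central_1 not0_implies_Suc diff_0_eq_0 One_nat_def diff_self_eq_0)
qed

lemma (in group_hom) commutator_subgroup_img:
  assumes "K \<subseteq> carrier G" "L \<subseteq> carrier G"
  shows "commutator_subgroup H (h ` K) (h ` L) = h ` commutator_subgroup G K L"
proof -
  let ?S = "\<Union>x\<in>K. \<Union>y\<in>L. {x \<otimes> y \<otimes> inv x \<otimes> inv y}"
  have "?S \<subseteq> carrier G" using assms by (auto simp: subset_iff)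
  moreover have "h ` ?S = (\<Union>x\<in>h ` K. \<Union>y\<in>h ` L. {x \<otimes>\<^bsub>H\<^esub> y \<otimes>\<^bsub>H\<^esub> inv\<^bsub>H\<^esub> x \<otimes>\<^bsub>H\<^esub> inv\<^bsub>H\<^esub> y})"
    using assms by (simp add: image_UN subset_iff)
  ultimately show ?thesis
    unfolding commutator_subgroup_def using generate_img[of ?S] by simp
qed

lemma (in group_hom) lower_central_img:
  assumes "h ` carrier G = carrier H" "k \<ge> 1"
  shows "lower_central H k = h ` lower_central G k"
  using assms(2)
proof (induction k rule: dec_induct)
  case base
  show ?case by (simp add: assms(1))
next
  case (step k)
  have "lower_central G k \<subseteq> carrier G"
    using G.lower_central_normal normal_imp_subgroup subgroup.subset by blast
  then show ?case
    using step commutator_subgroup_img[of "lower_central G k" "carrier G"]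
    by (simp add: lower_central_Suc assms(1))
qed

theorem (in group) residually_nilpotent_iff:
  "residually_nilpotent G \<longleftrightarrow> lower_central_omega G = {\<one>}"
proof
  have one: "\<one> \<in> lower_central G k" for k
    using lower_central_normal normal_imp_subgroup subgroup.one_closed by blast
  {
    assume R: "residually_nilpotent G"
    have "x = \<one>" if x: "x \<in> lower_central_omega G" for x
    proof (rule ccontr)
      assume "x \<noteq> \<one>"
      have xk: "x \<in> lower_central G k" if "k \<ge> 1" for k
        using x that by (auto simp: lower_central_omega_def)
      then have "x \<in> carrier G" using xk[of 1] by simp
      with \<open>x \<noteq> \<one>\<close> R obtain N s where N: "N \<lhd> G" "s \<ge> (2::nat)"
        "lower_central (G Mod N) s = {\<one>\<^bsub>G Mod N\<^esub>}" "N #> x \<noteq> \<one>\<^bsub>G Mod N\<^esub>"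
        unfolding residually_nilpotent_def nilpotent_group_def by (meson Diff_iff singletonD)
      interpret N: normal N G by fact
      interpret h: group_hom G "G Mod N" "\<lambda>x. N #> x"
        using N.r_coset_hom_Mod N.factorgroup_is_group
        by (simp add: group_hom_def group_hom_axioms_def group_axioms)
      have "lower_central (G Mod N) s = (\<lambda>x. N #> x) ` lower_central G s"
        using N(2) by (intro h.lower_central_img) (auto simp: carrier_FactGroup)
      with xk[of s] N show False by auto
    qed
    then show "lower_central_omega G = {\<one>}"
      using one by (auto simp: lower_central_omega_def)
  }
  assume O: "lower_central_omega G = {\<one>}"
  show "residually_nilpotent G"
    unfolding residually_nilpotent_def
  proof (intro conjI ballI group_axioms)
    fix x assume x: "x \<in> carrier G - {\<one>}"
    then obtain j where j: "j \<ge> 1" "x \<notin> lower_central G j"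
      using O by (auto simp: lower_central_omega_def)
    moreover have "j \<noteq> 1" using j x by auto
    ultimately have j2: "j \<ge> 2" by simp
    define N where "N = lower_central G j"
    have Nn: "N \<lhd> G" by (simp add: N_def lower_central_normal)
    interpret N: normal N G by fact
    interpret h: group_hom G "G Mod N" "\<lambda>x. N #> x"
      using N.r_coset_hom_Mod N.factorgroup_is_group
      by (simp add: group_hom_def group_hom_axioms_def group_axioms)
    have "lower_central (G Mod N) j = (\<lambda>x. N #> x) ` N"
      using h.lower_central_img[of j] j(1) by (auto simp: carrier_FactGroup N_def)
    also have "\<dots> = {\<one>\<^bsub>G Mod N\<^esub>}"
      using N.rcos_const one[of j] by (auto simp: N_def image_iff)
    finally have "nilpotent_group (G Mod N)"
      using j2 by (auto simp: nilpotent_group_def N.factorgroup_is_group)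
    moreover have "N #> x \<noteq> N"
      using j(2) x rcos_self[OF _ N.is_subgroup, of x] by (auto simp: N_def)
    ultimately show "\<exists>N. N \<lhd> G \<and> nilpotent_group (G Mod N) \<and> N #> x \<noteq> \<one>\<^bsub>G Mod N\<^esub>"
      using Nn by auto
  qed
qed

section \<open>Integral group rings\<close>

text \<open>The multiplication is the bilinear extension of the one of \<open>B\<close>.\<close>

definition integral_group_ring :: "('b, 'm) monoid_scheme \<Rightarrow> ('b \<Rightarrow>\<^sub>0 int) ring"
  where "integral_group_ring B =
    \<lparr>carrier = {x. Poly_Mapping.keys x \<subseteq> carrier B},
     monoid.mult = (\<lambda>x y. frag_extend (\<lambda>g. frag_extend (\<lambda>h. frag_of (g \<otimes>\<^bsub>B\<^esub> h)) y) x),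
     monoid.one = frag_of \<one>\<^bsub>B\<^esub>,
     ring.zero = 0,
     ring.add = (+)\<rparr>"

definition augmentation :: "('b \<Rightarrow>\<^sub>0 int) \<Rightarrow> int"
  where "augmentation x = (\<Sum>g\<in>Poly_Mapping.keys x. Poly_Mapping.lookup x g)"

definition augmentation_ideal :: "('b, 'm) monoid_scheme \<Rightarrow> ('b \<Rightarrow>\<^sub>0 int) set"
  where "augmentation_ideal B = a_kernel (integral_group_ring B) \<Z> augmentation"

text \<open>\<open>ideals_set R\<close> carries the monoid structure of the ideals of \<open>R\<close> under the product of
  ideals, with unit the whole ring.\<close>

definition augmentation_power :: "('b, 'm) monoid_scheme \<Rightarrow> nat \<Rightarrow> ('b \<Rightarrow>\<^sub>0 int) set"
  where "augmentation_power B n =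
    augmentation_ideal B [^]\<^bsub>ideals_set (integral_group_ring B)\<^esub> n"

lemma frag_extend_fun_add:
  "frag_extend (\<lambda>g. f g + k g) x = frag_extend f x + frag_extend k x"
  by (simp add: frag_extend_def frag_cmul_distrib2 sum.distrib)

lemma frag_extend_fun_diff:
  "frag_extend (\<lambda>g. f g - k g) x = frag_extend f x - frag_extend k x"
  using frag_extend_fun_add[of "\<lambda>g. f g - k g" k x] by simp

lemma integral_group_ring_is_ring:
  assumes "group B" shows "ring (integral_group_ring B)"
proof -
  interpret group B by fact
  let ?m = "\<lambda>x y. frag_extend (\<lambda>g. frag_extend (\<lambda>h. frag_of (g \<otimes>\<^bsub>B\<^esub> h)) y) x"
  let ?C = "{x. Poly_Mapping.keys x \<subseteq> carrier B}"
  have closed: "Poly_Mapping.keys (?m x y) \<subseteq> carrier B"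
    if "Poly_Mapping.keys x \<subseteq> carrier B" "Poly_Mapping.keys y \<subseteq> carrier B" for x y
  proof (rule order_trans[OF keys_frag_extend], rule UN_least)
    fix g assume "g \<in> Poly_Mapping.keys x"
    with that show "Poly_Mapping.keys (frag_extend (\<lambda>h. frag_of (g \<otimes>\<^bsub>B\<^esub> h)) y) \<subseteq> carrier B"
      by (intro order_trans[OF keys_frag_extend] UN_least) auto
  qed
  have addl: "?m (x - y) z = ?m x z - ?m y z" "?m (x + y) z = ?m x z + ?m y z" for x y z
    by (simp_all add: frag_extend_diff frag_extend_add)
  have addr: "?m x (y - z) = ?m x y - ?m x z" "?m x (y + z) = ?m x y + ?m x z" for x y z
    by (simp_all add: frag_extend_diff frag_extend_add frag_extend_fun_add frag_extend_fun_diff)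
  have assoc: "?m (?m x y) z = ?m x (?m y z)"
    if "x \<in> ?C" "y \<in> ?C" "z \<in> ?C" for x y z
  proof -
    have x: "Poly_Mapping.keys x \<subseteq> carrier B" and y: "Poly_Mapping.keys y \<subseteq> carrier B"
      and z: "Poly_Mapping.keys z \<subseteq> carrier B" using that by auto
    have 1: "?m (?m (frag_of a) (frag_of b)) z = ?m (frag_of a) (?m (frag_of b) z)"
      if "a \<in> carrier B" "b \<in> carrier B" for a b
      using z
    proof (induction z rule: frag_induction)
      case zero show ?case by simp
    next
      case (one c) then show ?case using that by (simp add: m_assoc)
    next
      case (diff u v) then show ?case by (simp only: addr)
    qed
    have 2: "?m (?m (frag_of a) y) z = ?m (frag_of a) (?m y z)" if "a \<in> carrier B" for a
      using y
    proof (induction y rule: frag_induction)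
      case zero show ?case by simp
    next
      case (one c) then show ?case using 1 that by blast
    next
      case (diff u v) then show ?case by (simp only: addr addl)
    qed
    show ?thesis
      using x
    proof (induction x rule: frag_induction)
      case zero show ?case by simp
    next
      case (one c) then show ?case using 2 by blast
    next
      case (diff u v) then show ?case by (simp only: addl)
    qed
  qed
  have unit: "?m (frag_of \<one>\<^bsub>B\<^esub>) x = x" "?m x (frag_of \<one>\<^bsub>B\<^esub>) = x" if "x \<in> ?C" for x
  proof -
    have x: "Poly_Mapping.keys x \<subseteq> carrier B" using that by auto
    have "?m (frag_of \<one>\<^bsub>B\<^esub>) x = frag_extend frag_of x"
      unfolding frag_extend_of using x by (intro frag_extend_eq) auto
    then show "?m (frag_of \<one>\<^bsub>B\<^esub>) x = x" by (simp flip: frag_expansion)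
    have "?m x (frag_of \<one>\<^bsub>B\<^esub>) = frag_extend frag_of x"
      unfolding frag_extend_of using x by (intro frag_extend_eq) auto
    then show "?m x (frag_of \<one>\<^bsub>B\<^esub>) = x" by (simp flip: frag_expansion)
  qed
  have ag: "abelian_group (integral_group_ring B)"
  proof (rule abelian_groupI)
    fix x assume "x \<in> carrier (integral_group_ring B)"
    then show "\<exists>y\<in>carrier (integral_group_ring B).
        y \<oplus>\<^bsub>integral_group_ring B\<^esub> x = \<zero>\<^bsub>integral_group_ring B\<^esub>"
      by (intro bexI[of _ "- x"]) (auto simp: integral_group_ring_def)
  qed (use keys_add in \<open>fastforce simp: integral_group_ring_def algebra_simps\<close>)+
  have mon: "Group.monoid (integral_group_ring B)"
  proof (rule monoidI)
    fix x y z
    show "\<lbrakk>x \<in> carrier (integral_group_ring B); y \<in> carrier (integral_group_ring B)\<rbrakk> \<Longrightarrow>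
      x \<otimes>\<^bsub>integral_group_ring B\<^esub> y \<in> carrier (integral_group_ring B)"
      using closed[of x y] by (simp add: integral_group_ring_def)
    show "\<lbrakk>x \<in> carrier (integral_group_ring B); y \<in> carrier (integral_group_ring B);
        z \<in> carrier (integral_group_ring B)\<rbrakk> \<Longrightarrow>
      x \<otimes>\<^bsub>integral_group_ring B\<^esub> y \<otimes>\<^bsub>integral_group_ring B\<^esub> z =
      x \<otimes>\<^bsub>integral_group_ring B\<^esub> (y \<otimes>\<^bsub>integral_group_ring B\<^esub> z)"
      using assoc[of x y z] by (simp add: integral_group_ring_def)
  qed (use unit in \<open>auto simp: integral_group_ring_def\<close>)
  show ?thesis
    by (intro ringI ag mon) (simp_all add: integral_group_ring_def addl addr)
qed

lemma augmentation_eq: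
  "\<lbrakk>finite S; Poly_Mapping.keys x \<subseteq> S\<rbrakk> \<Longrightarrow> augmentation x = (\<Sum>g\<in>S. Poly_Mapping.lookup x g)"
  unfolding augmentation_def by (intro sum.mono_neutral_left) (auto simp: in_keys_iff)

lemma augmentation_diff: "augmentation (x - y) = augmentation x - augmentation y"
  using keys_diff[of x y]
  by (simp add: augmentation_eq[of "Poly_Mapping.keys x \<union> Poly_Mapping.keys y"]
      lookup_minus sum_subtractf)

lemma augmentation_frag_of [simp]: "augmentation (frag_of g) = 1"
  by (simp add: augmentation_def)

lemma frag_of_diff_in_augmentation_ideal:
  "\<lbrakk>g \<in> carrier B; h \<in> carrier B\<rbrakk> \<Longrightarrow> frag_of g - frag_of h \<in> augmentation_ideal B"
  using keys_diff[of "frag_of g" "frag_of h"]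
  by (auto simp: augmentation_ideal_def a_kernel_def' integral_group_ring_def augmentation_diff)

section \<open>Group extensions and the module structure on the abelianised kernel\<close>

text \<open>The library's \<open>short_exact_sequence\<close> forces all groups to live on a single type.\<close>

locale group_extension = A: group A + G: group G + B: group B
  for A :: "('a, 'm) monoid_scheme" and G :: "('g, 'n) monoid_scheme"
    and B :: "('b, 'k) monoid_scheme" and \<iota> :: "'a \<Rightarrow> 'g" and \<pi> :: "'g \<Rightarrow> 'b" +
  assumes inclusion: "\<iota> \<in> mon A G"
    and projection: "\<pi> \<in> epi G B"
    and exact: "\<iota> ` carrier A = kernel G B \<pi>"

definition abelianization :: "('a, 'm) monoid_scheme \<Rightarrow> 'a set monoid"
  where "abelianization A = A Mod lower_central A 2"

text \<open>The action of \<open>b\<close> on a coset \<open>U\<close> by conjugation, collected over all lifts \<open>g\<close> of \<open>b\<close>, so that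
  no lift has to be chosen; the lemma \<open>conj_action_coset\<close> below shows that any single lift
  already gives the whole set.\<close>

definition conj_action ::
  "('a, 'm) monoid_scheme \<Rightarrow> ('g, 'n) monoid_scheme \<Rightarrow> ('a \<Rightarrow> 'g) \<Rightarrow> ('g \<Rightarrow> 'b) \<Rightarrow> 'b \<Rightarrow> 'a set \<Rightarrow> 'a set"
  where "conj_action A G \<iota> \<pi> b U =
    {a' \<in> carrier A. \<exists>g\<in>carrier G. \<exists>a\<in>U. \<pi> g = b \<and> \<iota> a' = g \<otimes>\<^bsub>G\<^esub> \<iota> a \<otimes>\<^bsub>G\<^esub> inv\<^bsub>G\<^esub> g}"

text \<open>The linear extension of this action to the integral group ring. The abelianization is
  written multiplicatively, so sums become products and integer multiples become powers.\<close>

definition group_ring_action ::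
  "('a, 'm) monoid_scheme \<Rightarrow> ('g, 'n) monoid_scheme \<Rightarrow> ('a \<Rightarrow> 'g) \<Rightarrow> ('g \<Rightarrow> 'b) \<Rightarrow>
    ('b \<Rightarrow>\<^sub>0 int) \<Rightarrow> 'a set \<Rightarrow> 'a set"
  where "group_ring_action A G \<iota> \<pi> x U =
    (\<Otimes>\<^bsub>abelianization A\<^esub>b\<in>Poly_Mapping.keys x.
      conj_action A G \<iota> \<pi> b U [^]\<^bsub>abelianization A\<^esub> Poly_Mapping.lookup x b)"

definition ideal_times_abelianization ::
  "('a, 'm) monoid_scheme \<Rightarrow> ('g, 'n) monoid_scheme \<Rightarrow> ('a \<Rightarrow> 'g) \<Rightarrow> ('g \<Rightarrow> 'b) \<Rightarrow>
    ('b \<Rightarrow>\<^sub>0 int) set \<Rightarrow> 'a set set"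
  where "ideal_times_abelianization A G \<iota> \<pi> I =
    generate (abelianization A)
      {group_ring_action A G \<iota> \<pi> x U | x U. x \<in> I \<and> U \<in> carrier (abelianization A)}"

lemma (in group) abelianization_comm_group: "comm_group (abelianization G)"
  by (simp add: abelianization_def lower_central_2 derived_quot_is_comm_group)

context group_extension
begin

sublocale \<iota>: group_hom A G \<iota>
  using inclusion by unfold_locales (simp add: mon_def)

sublocale \<pi>: group_hom G B \<pi>
  using projection by unfold_locales (simp add: epi_def)

lemma inj: "\<lbrakk>\<iota> a = \<iota> a'; a \<in> carrier A; a' \<in> carrier A\<rbrakk> \<Longrightarrow> a = a'"
  using inclusion by (auto simp: mon_def inj_on_def)

definition conj_by :: "'g \<Rightarrow> 'a \<Rightarrow> 'a"
  where "conj_by g a = inv_into (carrier A) \<iota> (g \<otimes>\<^bsub>G\<^esub> \<iota> a \<otimes>\<^bsub>G\<^esub> inv\<^bsub>G\<^esub> g)"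

lemma conj_by:
  assumes "g \<in> carrier G" "a \<in> carrier A"
  shows "conj_by g a \<in> carrier A" "\<iota> (conj_by g a) = g \<otimes>\<^bsub>G\<^esub> \<iota> a \<otimes>\<^bsub>G\<^esub> inv\<^bsub>G\<^esub> g"
proof -
  have "\<iota> a \<in> kernel G B \<pi>" using assms exact by blast
  then have "g \<otimes>\<^bsub>G\<^esub> \<iota> a \<otimes>\<^bsub>G\<^esub> inv\<^bsub>G\<^esub> g \<in> \<iota> ` carrier A"
    using assms by (simp add: exact kernel_def)
  then show "conj_by g a \<in> carrier A" "\<iota> (conj_by g a) = g \<otimes>\<^bsub>G\<^esub> \<iota> a \<otimes>\<^bsub>G\<^esub> inv\<^bsub>G\<^esub> g"
    by (simp_all add: conj_by_def inv_into_into f_inv_into_f)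
qed

lemma conj_by_hom: "g \<in> carrier G \<Longrightarrow> conj_by g \<in> hom A A"
proof (rule homI)
  fix a b assume *: "g \<in> carrier G" "a \<in> carrier A" "b \<in> carrier A"
  have "inv\<^bsub>G\<^esub> g \<otimes>\<^bsub>G\<^esub> (g \<otimes>\<^bsub>G\<^esub> z) = z" if "z \<in> carrier G" for z
    using that * by (simp flip: G.m_assoc)
  then show "conj_by g (a \<otimes>\<^bsub>A\<^esub> b) = conj_by g a \<otimes>\<^bsub>A\<^esub> conj_by g b"
    using * by (intro inj) (simp_all add: conj_by G.m_assoc)
qed (simp add: conj_by)

lemma conj_by_mult:
  "\<lbrakk>g \<in> carrier G; h \<in> carrier G; a \<in> carrier A\<rbrakk> \<Longrightarrow> conj_by (g \<otimes>\<^bsub>G\<^esub> h) a = conj_by g (conj_by h a)"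
  by (intro inj) (simp_all add: conj_by G.m_assoc G.inv_mult_group)

lemma conj_by_image: "c \<in> carrier A \<Longrightarrow> a \<in> carrier A \<Longrightarrow> conj_by (\<iota> c) a = c \<otimes>\<^bsub>A\<^esub> a \<otimes>\<^bsub>A\<^esub> inv\<^bsub>A\<^esub> c"
  by (intro inj) (simp_all add: conj_by)

lemma conj_by_derived:
  assumes g: "g \<in> carrier G" and d: "d \<in> lower_central A 2"
  shows "conj_by g d \<in> lower_central A 2"
proof -
  interpret c: group_hom A A "conj_by g"
    using conj_by_hom[OF g] by unfold_locales
  have "conj_by g ` carrier A \<subseteq> carrier A" using conj_by(1)[OF g] by auto
  then have "derived A (conj_by g ` carrier A) \<subseteq> derived A (carrier A)"
    by (rule A.mono_derived)
  then show ?thesis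
    using d c.derived_img[of "carrier A"] by (auto simp: lower_central_2)
qed

lemma conj_action_coset:
  assumes g: "g \<in> carrier G" and a: "a \<in> carrier A"
  shows "conj_action A G \<iota> \<pi> (\<pi> g) (lower_central A 2 #>\<^bsub>A\<^esub> a) = lower_central A 2 #>\<^bsub>A\<^esub> conj_by g a"
    (is "?L = ?R")
proof -
  let ?D = "lower_central A 2"
  interpret D: normal ?D A by (rule A.lower_central_normal)
  interpret q: comm_group "A Mod ?D"
    using A.abelianization_comm_group by (simp add: abelianization_def)
  have cos: "?D #>\<^bsub>A\<^esub> conj_by h x = ?D #>\<^bsub>A\<^esub> conj_by h y"
    if "h \<in> carrier G" "x \<in> carrier A" "y \<in> carrier A" and xy: "x \<in> ?D #>\<^bsub>A\<^esub> y" for h x y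
  proof -
    obtain d where d: "d \<in> ?D" "x = d \<otimes>\<^bsub>A\<^esub> y" using xy by (auto simp: r_coset_def)
    have "conj_by h x = conj_by h d \<otimes>\<^bsub>A\<^esub> conj_by h y"
      using conj_by_hom[OF that(1)] d that by (simp add: hom_def D.mem_carrier)
    then have "conj_by h x \<in> ?D #>\<^bsub>A\<^esub> conj_by h y"
      using conj_by_derived[OF that(1) d(1)] by (auto simp: r_coset_def)
    then show ?thesis
      using A.repr_independence[OF _ _ D.is_subgroup] that by (simp add: conj_by)
  qed
  have inner: "?D #>\<^bsub>A\<^esub> conj_by (\<iota> c) x = ?D #>\<^bsub>A\<^esub> x" if "c \<in> carrier A" "x \<in> carrier A" for c x
  proof -
    have "?D #>\<^bsub>A\<^esub> (c \<otimes>\<^bsub>A\<^esub> x) = ?D #>\<^bsub>A\<^esub> (x \<otimes>\<^bsub>A\<^esub> c)"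
      using q.m_comm[of "?D #>\<^bsub>A\<^esub> c" "?D #>\<^bsub>A\<^esub> x"] that
      by (simp add: carrier_FactGroup D.rcos_sum)
    then have "?D #>\<^bsub>A\<^esub> (c \<otimes>\<^bsub>A\<^esub> x) #>\<^bsub>A\<^esub> inv\<^bsub>A\<^esub> c = ?D #>\<^bsub>A\<^esub> (x \<otimes>\<^bsub>A\<^esub> c) #>\<^bsub>A\<^esub> inv\<^bsub>A\<^esub> c"
      by simp
    then show ?thesis
      using that by (simp add: conj_by_image A.coset_mult_assoc D.subset A.m_assoc)
  qed
  show ?thesis
  proof
    show "?L \<subseteq> ?R"
    proof
      fix y assume "y \<in> ?L"
      then obtain h x where y: "y \<in> carrier A" "h \<in> carrier G" "x \<in> ?D #>\<^bsub>A\<^esub> a" "\<pi> h = \<pi> g"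
        "\<iota> y = h \<otimes>\<^bsub>G\<^esub> \<iota> x \<otimes>\<^bsub>G\<^esub> inv\<^bsub>G\<^esub> h"
        by (auto simp: conj_action_def)
      have x: "x \<in> carrier A" using y(3) a A.r_coset_subset_G[OF D.subset] by blast
      have yx: "y = conj_by h x" using y x by (intro inj) (simp_all add: conj_by)
      have "h \<otimes>\<^bsub>G\<^esub> inv\<^bsub>G\<^esub> g \<in> kernel G B \<pi>" using y g by (simp add: kernel_def)
      then obtain c where c: "c \<in> carrier A" "\<iota> c = h \<otimes>\<^bsub>G\<^esub> inv\<^bsub>G\<^esub> g"
        using exact by (metis imageE)
      have "h = \<iota> c \<otimes>\<^bsub>G\<^esub> g" using c y g by (simp add: G.m_assoc)
      then have "y = conj_by (\<iota> c \<otimes>\<^bsub>G\<^esub> g) x"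
        using yx by metis
      also have "\<dots> = conj_by (\<iota> c) (conj_by g x)"
        using c(1) g x by (intro conj_by_mult) auto
      finally have "y = conj_by (\<iota> c) (conj_by g x)" .
      then have "?D #>\<^bsub>A\<^esub> y = ?R"
        using inner[OF c(1), of "conj_by g x"] cos[OF g x a y(3)] g x by (simp add: conj_by)
      then show "y \<in> ?R" using A.rcos_self[OF y(1) D.is_subgroup] by simp
    qed
    show "?R \<subseteq> ?L"
    proof
      fix y assume "y \<in> ?R"
      then obtain d where d: "d \<in> ?D" "y = d \<otimes>\<^bsub>A\<^esub> conj_by g a" by (auto simp: r_coset_def)
      have dA: "d \<in> carrier A" using d(1) by (rule D.mem_carrier)
      define e where "e = conj_by (inv\<^bsub>G\<^esub> g) d"
      have e: "e \<in> ?D" "e \<in> carrier A"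
        using g d(1) dA by (simp_all add: e_def conj_by conj_by_derived)
      have "conj_by g e = d"
        using g dA
        by (intro inj) (simp_all add: e_def conj_by G.m_assoc flip: G.m_assoc[of g "inv\<^bsub>G\<^esub> g"])
      then have "y = conj_by g (e \<otimes>\<^bsub>A\<^esub> a)"
        using d conj_by_hom[OF g] e a by (simp add: hom_def)
      moreover have "e \<otimes>\<^bsub>A\<^esub> a \<in> ?D #>\<^bsub>A\<^esub> a" using e by (auto simp: r_coset_def)
      ultimately show "y \<in> ?L"
        using g conj_by[OF g, of "e \<otimes>\<^bsub>A\<^esub> a"] e a
        unfolding conj_action_def by (intro CollectI conjI bexI[of _ g] bexI[of _ "e \<otimes>\<^bsub>A\<^esub> a"]) auto
    qed
  qed
qed

lemma abelianization_cosetE: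
  assumes "U \<in> carrier (abelianization A)"
  obtains a where "a \<in> carrier A" "U = lower_central A 2 #>\<^bsub>A\<^esub> a"
  using assms by (auto simp: abelianization_def carrier_FactGroup)

lemma conj_action_mult:
  assumes "b \<in> carrier B" "c \<in> carrier B" "U \<in> carrier (abelianization A)"
  shows "conj_action A G \<iota> \<pi> (b \<otimes>\<^bsub>B\<^esub> c) U = conj_action A G \<iota> \<pi> b (conj_action A G \<iota> \<pi> c U)"
proof -
  obtain g h where gh: "g \<in> carrier G" "h \<in> carrier G" "b = \<pi> g" "c = \<pi> h"
    using assms projection unfolding epi_def by (metis (mono_tags, lifting) imageE mem_Collect_eq)
  obtain a where a: "a \<in> carrier A" "U = lower_central A 2 #>\<^bsub>A\<^esub> a"
    using assms(3) by (rule abelianization_cosetE)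
  show ?thesis
    using conj_action_coset[of "g \<otimes>\<^bsub>G\<^esub> h" a] gh a by (simp add: conj_action_coset conj_by conj_by_mult)
qed

lemma conj_action_hom:
  assumes "b \<in> carrier B"
  shows "conj_action A G \<iota> \<pi> b \<in> hom (abelianization A) (abelianization A)"
proof -
  interpret D: normal "lower_central A 2" A by (rule A.lower_central_normal)
  obtain g where g: "g \<in> carrier G" "b = \<pi> g"
    using assms projection by (auto simp: epi_def)
  show ?thesis
  proof (rule homI)
    fix U V assume "U \<in> carrier (abelianization A)" "V \<in> carrier (abelianization A)"
    then obtain a c where ac: "a \<in> carrier A" "U = lower_central A 2 #>\<^bsub>A\<^esub> a"
      "c \<in> carrier A" "V = lower_central A 2 #>\<^bsub>A\<^esub> c"
      by (elim abelianization_cosetE)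
    show "conj_action A G \<iota> \<pi> b U \<in> carrier (abelianization A)"
      using g ac by (auto simp: conj_action_coset conj_by abelianization_def carrier_FactGroup)
    show "conj_action A G \<iota> \<pi> b (U \<otimes>\<^bsub>abelianization A\<^esub> V) =
      conj_action A G \<iota> \<pi> b U \<otimes>\<^bsub>abelianization A\<^esub> conj_action A G \<iota> \<pi> b V"
      using g ac conj_by_hom[OF g(1)]
      by (simp add: abelianization_def D.rcos_sum conj_action_coset conj_by hom_def)
  qed
qed

lemma group_ring_action_frag_of:
  assumes "b \<in> carrier B" "U \<in> carrier (abelianization A)"
  shows "group_ring_action A G \<iota> \<pi> (frag_of b) U = conj_action A G \<iota> \<pi> b U"
proof -
  interpret Ab: comm_group "abelianization A" by (rule A.abelianization_comm_group)
  have "conj_action A G \<iota> \<pi> b U \<in> carrier (abelianization A)"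
    using conj_action_hom[OF assms(1)] assms(2) by (auto simp: hom_def)
  then show ?thesis
    by (simp add: group_ring_action_def keys_frag_of Ab.int_pow_1)
qed

lemma group_ring_action_add:
  assumes xy: "x \<in> carrier (integral_group_ring B)" "y \<in> carrier (integral_group_ring B)"
    and U: "U \<in> carrier (abelianization A)"
  shows "group_ring_action A G \<iota> \<pi> (x \<oplus>\<^bsub>integral_group_ring B\<^esub> y) U =
    group_ring_action A G \<iota> \<pi> x U \<otimes>\<^bsub>abelianization A\<^esub> group_ring_action A G \<iota> \<pi> y U"
proof -
  interpret Ab: comm_group "abelianization A" by (rule A.abelianization_comm_group)
  let ?S = "Poly_Mapping.keys x \<union> Poly_Mapping.keys y"
  let ?t = "\<lambda>z b. conj_action A G \<iota> \<pi> b U [^]\<^bsub>abelianization A\<^esub> Poly_Mapping.lookup z b"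
  have S: "?S \<subseteq> carrier B" using xy by (auto simp: integral_group_ring_def)
  have cl: "conj_action A G \<iota> \<pi> b U \<in> carrier (abelianization A)" if "b \<in> ?S" for b
    using conj_action_hom[of b] S U that by (auto simp: hom_def)
  have ext: "group_ring_action A G \<iota> \<pi> z U = finprod (abelianization A) (?t z) ?S"
    if "Poly_Mapping.keys z \<subseteq> ?S" for z
    unfolding group_ring_action_def using that cl
    by (intro Ab.finprod_mono_neutral_cong_left) (auto simp: in_keys_iff)
  have "group_ring_action A G \<iota> \<pi> (x + y) U = finprod (abelianization A) (?t (x + y)) ?S"
    using keys_add by (rule ext)
  also have "\<dots> = finprod (abelianization A) (\<lambda>b. ?t x b \<otimes>\<^bsub>abelianization A\<^esub> ?t y b) ?S"
    using cl by (intro Ab.finprod_cong') (auto simp: lookup_add Ab.int_pow_mult)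
  also have "\<dots> = finprod (abelianization A) (?t x) ?S \<otimes>\<^bsub>abelianization A\<^esub> finprod (abelianization A) (?t y) ?S"
    using cl by (intro Ab.finprod_multf) auto
  finally show ?thesis
    using ext[of x] ext[of y] by (simp add: integral_group_ring_def)
qed

end

end

theory Submission
  imports Defs
begin

text \<open>Write \<open>[H, \<^sub>n G]\<close> for the \<open>n\<close>-fold commutator of \<open>H\<close> with \<open>G\<close>. Since \<open>(1 - b)\<close> acts on the
  abelianization of \<open>A\<close> as the commutator with a lift of \<open>b\<close>, the hypothesis on the augmentation
  ideal gives \<open>[A, \<^sub>N G] \<subseteq> \<gamma>\<^sub>2(A)\<close>. By the three subgroups lemma, \<open>[[H, L], \<^sub>m G]\<close> is controlled by
  the subgroups \<open>[[H, \<^sub>i G], [L, \<^sub>j G]]\<close> with \<open>i + j = m\<close>; applied to \<open>\<gamma>\<^sub>k\<^sub>+\<^sub>1(A) = [\<gamma>\<^sub>k(A), A]\<close> this yields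
  inductively an \<open>M\<close> with \<open>[\<gamma>\<^sub>k(A), \<^sub>M G] \<subseteq> \<gamma>\<^sub>k\<^sub>+\<^sub>1(A)\<close>. As \<open>B\<close> is nilpotent, some \<open>\<gamma>\<^sub>s(G)\<close> lies in \<open>A\<close>, so
  every \<open>\<gamma>\<^sub>k(A)\<close> contains a term of the lower central series of \<open>G\<close>.\<close>

section \<open>Centralizers modulo a normal subgroup\<close>

text \<open>For normal \<open>K\<close> this is the preimage in \<open>G\<close> of the centralizer
  of the image of \<open>Z\<close> in \<open>G / K\<close>; with \<open>Z = carrier G\<close> it is
  the preimage of the centre of \<open>G / K\<close>.\<close>

definition centralizer_mod :: "('a, 'm) monoid_scheme \<Rightarrow> 'a set \<Rightarrow> 'a set \<Rightarrow> 'a set"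
  where "centralizer_mod G K Z =
    {c \<in> carrier G. \<forall>z\<in>Z. c \<otimes>\<^bsub>G\<^esub> z \<otimes>\<^bsub>G\<^esub> inv\<^bsub>G\<^esub> c \<otimes>\<^bsub>G\<^esub> inv\<^bsub>G\<^esub> z \<in> K}"

context group
begin

lemma inv_mult_cancel:
  assumes "x \<in> carrier G" "y \<in> carrier G"
  shows "inv x \<otimes> (x \<otimes> y) = y" "x \<otimes> (inv x \<otimes> y) = y"
  using assms by (simp_all flip: m_assoc)

text \<open>Holds because x y x^-1 y^-1 = (x y)(y x)^-1. It converts membership in \<open>K\<close>
  into an equation of cosets, in which products can be rewritten factor by factor.\<close>

lemma commutator_in_normal_iff:
  assumes "K \<lhd> G" "x \<in> carrier G" "y \<in> carrier G"
  shows "x \<otimes> y \<otimes> inv x \<otimes> inv y \<in> K \<longleftrightarrow> K #> x \<otimes> y = K #> y \<otimes> x"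
proof -
  interpret K: normal K G by fact
  have e: "x \<otimes> y \<otimes> inv x \<otimes> inv y = (x \<otimes> y) \<otimes> inv (y \<otimes> x)"
    using assms by (simp add: inv_mult_group m_assoc)
  show ?thesis
  proof
    assume "x \<otimes> y \<otimes> inv x \<otimes> inv y \<in> K"
    then have "(x \<otimes> y) \<otimes> inv (y \<otimes> x) \<in> K" using e by simp
    then have "x \<otimes> y \<in> K #> (y \<otimes> x)"
      using assms unfolding r_coset_def
      by (auto intro!: bexI[of _ "(x \<otimes> y) \<otimes> inv (y \<otimes> x)"] simp: inv_mult_group m_assoc inv_mult_cancel)
    then show "K #> x \<otimes> y = K #> y \<otimes> x"
      using repr_independence[OF _ _ K.is_subgroup] assms by simp
  next
    assume "K #> x \<otimes> y = K #> y \<otimes> x"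
    then have "x \<otimes> y \<in> K #> (y \<otimes> x)"
      using rcos_self[OF _ K.is_subgroup, of "x \<otimes> y"] assms by simp
    then obtain d where d: "d \<in> K" "x \<otimes> y = d \<otimes> (y \<otimes> x)" by (auto simp: r_coset_def)
    then have "(x \<otimes> y) \<otimes> inv (y \<otimes> x) = d"
      using assms K.mem_carrier[OF d(1)] by (simp add: inv_solve_right')
    then show "x \<otimes> y \<otimes> inv x \<otimes> inv y \<in> K" using e d by simp
  qed
qed

text \<open>With [c, z] = c z c^-1 z^-1, closure follows from [c^-1, z] = c^-1 [c, z]^-1 c and
  [c d, z] = (c [d, z] c^-1) [c, z]; normality of \<open>K\<close> absorbs the conjugations.\<close>

lemma centralizer_mod_subgroup:
  assumes K: "K \<lhd> G" and Z: "Z \<subseteq> carrier G"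
  shows "subgroup (centralizer_mod G K Z) G"
proof -
  interpret K: normal K G by fact
  show ?thesis
  proof (rule subgroupI)
    show "centralizer_mod G K Z \<subseteq> carrier G" by (auto simp: centralizer_mod_def)
    have "\<one> \<in> centralizer_mod G K Z"
      using Z by (auto simp: centralizer_mod_def subset_iff)
    then show "centralizer_mod G K Z \<noteq> {}" by blast
    fix c assume c: "c \<in> centralizer_mod G K Z"
    then have cc: "c \<in> carrier G" by (simp add: centralizer_mod_def)
    show "inv c \<in> centralizer_mod G K Z"
      unfolding centralizer_mod_def
    proof (intro CollectI conjI ballI)
      fix z assume z: "z \<in> Z"
      then have zc: "z \<in> carrier G" using Z by blast
      let ?k = "c \<otimes> z \<otimes> inv c \<otimes> inv z"
      have "?k \<in> K" using c z by (simp add: centralizer_mod_def)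
      then have "inv c \<otimes> inv ?k \<otimes> c \<in> K" using cc by (intro K.inv_op_closed1) auto
      moreover have "inv c \<otimes> inv ?k \<otimes> c = inv c \<otimes> z \<otimes> inv (inv c) \<otimes> inv z"
        using cc zc by (simp add: inv_mult_group m_assoc inv_mult_cancel)
      ultimately show "inv c \<otimes> z \<otimes> inv (inv c) \<otimes> inv z \<in> K" by simp
    qed (use cc in simp)
    fix d assume d: "d \<in> centralizer_mod G K Z"
    then have dc: "d \<in> carrier G" by (simp add: centralizer_mod_def)
    show "c \<otimes> d \<in> centralizer_mod G K Z"
      unfolding centralizer_mod_def
    proof (intro CollectI conjI ballI)
      fix z assume z: "z \<in> Z"
      then have zc: "z \<in> carrier G" using Z by blast
      let ?k = "c \<otimes> z \<otimes> inv c \<otimes> inv z" and ?l = "d \<otimes> z \<otimes> inv d \<otimes> inv z"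
      have "?k \<in> K" "?l \<in> K" using c d z by (simp_all add: centralizer_mod_def)
      then have "(c \<otimes> ?l \<otimes> inv c) \<otimes> ?k \<in> K" using cc by (simp add: K.inv_op_closed2)
      moreover have "(c \<otimes> ?l \<otimes> inv c) \<otimes> ?k = c \<otimes> d \<otimes> z \<otimes> inv (c \<otimes> d) \<otimes> inv z"
        using cc dc zc by (simp add: inv_mult_group m_assoc inv_mult_cancel)
      ultimately show "c \<otimes> d \<otimes> z \<otimes> inv (c \<otimes> d) \<otimes> inv z \<in> K" by simp
    qed (use cc dc in simp)
  qed
qed

lemma centralizer_mod_normal:
  assumes K: "K \<lhd> G"
  shows "centralizer_mod G K (carrier G) \<lhd> G"
proof -
  interpret K: normal K G by fact
  have "g \<otimes> c \<otimes> inv g \<in> centralizer_mod G K (carrier G)"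
    if g: "g \<in> carrier G" and c: "c \<in> centralizer_mod G K (carrier G)" for g c
    unfolding centralizer_mod_def
  proof (intro CollectI conjI ballI)
    have cc: "c \<in> carrier G" using c by (simp add: centralizer_mod_def)
    then show "g \<otimes> c \<otimes> inv g \<in> carrier G" using g by simp
    fix z assume z: "z \<in> carrier G"
    \<comment> \<open>The identity is [g c g^-1, z] = g [c, w] g^-1; since \<open>z\<close> ranges
      over the whole group, \<open>w\<close> is again an admissible test element.\<close>
    define w where "w = inv g \<otimes> z \<otimes> g"
    have w: "w \<in> carrier G" using g z by (simp add: w_def)
    have "g \<otimes> (c \<otimes> w \<otimes> inv c \<otimes> inv w) \<otimes> inv g \<in> K"
      using c w g by (intro K.inv_op_closed2) (auto simp: centralizer_mod_def)
    moreover have "g \<otimes> (c \<otimes> w \<otimes> inv c \<otimes> inv w) \<otimes> inv g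
        = g \<otimes> c \<otimes> inv g \<otimes> z \<otimes> inv (g \<otimes> c \<otimes> inv g) \<otimes> inv z"
      using g cc z by (simp add: w_def inv_mult_group m_assoc inv_mult_cancel)
    ultimately show "g \<otimes> c \<otimes> inv g \<otimes> z \<otimes> inv (g \<otimes> c \<otimes> inv g) \<otimes> inv z \<in> K" by simp
  qed
  then show ?thesis
    using centralizer_mod_subgroup[OF K order_refl] by (simp add: normal_inv_iff)
qed

section \<open>Inclusions of commutator subgroups and the three subgroups lemma\<close>

lemma commutator_in_subgroup:
  "\<lbrakk>x \<in> H; y \<in> Y\<rbrakk> \<Longrightarrow> x \<otimes> y \<otimes> inv x \<otimes> inv y \<in> commutator_subgroup G H Y"
  unfolding commutator_subgroup_def by (rule generate.incl) blast

lemma commutator_subgroup_m_inv: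
  assumes "H \<subseteq> carrier G" "Y \<subseteq> carrier G" "c \<in> commutator_subgroup G H Y"
  shows "inv c \<in> commutator_subgroup G H Y"
  using assms unfolding commutator_subgroup_def
  by (intro generate_m_inv_closed) (auto simp: subset_iff)

text \<open>It suffices to test generators, as \<open>K\<close> is a subgroup. The equivalence moves
  a commutator with \<open>Z\<close> from the left of an inclusion to a centralizer on the right,
  which drives the later inductions.\<close>

lemma commutator_subgroup_subset_iff:
  assumes "subgroup K G" "H \<subseteq> carrier G"
  shows "commutator_subgroup G H Z \<subseteq> K \<longleftrightarrow> H \<subseteq> centralizer_mod G K Z"
proof
  assume *: "commutator_subgroup G H Z \<subseteq> K"
  then show "H \<subseteq> centralizer_mod G K Z"
    using commutator_in_subgroup[of _ H _ Z] assms(2) by (auto simp: centralizer_mod_def)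
next
  assume "H \<subseteq> centralizer_mod G K Z"
  then show "commutator_subgroup G H Z \<subseteq> K"
    unfolding commutator_subgroup_def
    by (intro generate_subgroup_incl[OF _ assms(1)]) (auto simp: centralizer_mod_def)
qed

lemma commutator_subgroup_mono:
  "\<lbrakk>H \<subseteq> H'; Y \<subseteq> Y'; H' \<subseteq> carrier G; Y' \<subseteq> carrier G\<rbrakk> \<Longrightarrow>
    commutator_subgroup G H Y \<subseteq> commutator_subgroup G H' Y'"
  unfolding commutator_subgroup_def by (intro mono_generate) blast

lemma commutator_subgroup_carrier:
  assumes "H \<subseteq> carrier G" "Y \<subseteq> carrier G"
  shows "commutator_subgroup G H Y \<subseteq> carrier G"
  unfolding commutator_subgroup_def
  using assms by (intro generate_incl) (auto simp: subset_iff)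

text \<open>Since [y, x] = [x, y]^-1, the order of the two arguments can be exchanged below any
  subgroup.\<close>

lemma commutator_subgroup_commute_subset:
  assumes K: "subgroup K G" and H: "H \<subseteq> carrier G" and Y: "Y \<subseteq> carrier G"
    and XY: "commutator_subgroup G H Y \<subseteq> K"
  shows "commutator_subgroup G Y H \<subseteq> K"
proof -
  have "y \<otimes> x \<otimes> inv y \<otimes> inv x \<in> K" if "y \<in> Y" "x \<in> H" for x y
  proof -
    have "x \<otimes> y \<otimes> inv x \<otimes> inv y \<in> K"
      using XY that commutator_subgroup_subset_iff[OF K H] by (auto simp: centralizer_mod_def)
    then have "inv (x \<otimes> y \<otimes> inv x \<otimes> inv y) \<in> K" by (rule subgroup.m_inv_closed[OF K])
    moreover have "x \<in> carrier G" "y \<in> carrier G" using that H Y by auto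
    ultimately show ?thesis by (simp add: inv_mult_group m_assoc)
  qed
  then show ?thesis
    using Y by (auto simp: commutator_subgroup_subset_iff[OF K Y] centralizer_mod_def)
qed

text \<open>Modulo \<open>K\<close>, conjugation by an element of \<open>Z\<close> multiplies each x
  in \<open>H\<close> by a factor centralizing \<open>Y\<close>, and each y in \<open>Y\<close> by a
  factor centralizing \<open>H\<close>. Neither factor changes [x, y], so [x, y] commutes with
  \<open>Z\<close> modulo \<open>K\<close>. This direct argument replaces the Hall-Witt
  identity.\<close>

lemma three_subgroups:
  assumes K: "K \<lhd> G" and H: "H \<lhd> G" and Y: "Y \<lhd> G" and Z: "Z \<subseteq> carrier G"
    and XZ: "commutator_subgroup G (commutator_subgroup G H Z) Y \<subseteq> K"
    and YZ: "commutator_subgroup G H (commutator_subgroup G Y Z) \<subseteq> K"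
  shows "commutator_subgroup G (commutator_subgroup G H Y) Z \<subseteq> K"
proof -
  interpret K: normal K G by fact
  interpret H: normal H G by fact
  interpret Y: normal Y G by fact
  interpret Q: group "G Mod K" by (rule K.factorgroup_is_group)
  interpret q: group_hom G "G Mod K" "\<lambda>x. K #> x"
    using K.r_coset_hom_Mod K.factorgroup_is_group
    by (simp add: group_hom_def group_hom_axioms_def group_axioms)
  let ?q = "\<lambda>x. K #> x"
  have comm_carr: "commutator_subgroup G H Z \<subseteq> carrier G" "commutator_subgroup G Y Z \<subseteq> carrier G"
    by (simp_all add: commutator_subgroup_carrier H.subset Y.subset Z)
  have commuting: "?q (c \<otimes> v \<otimes> w) = ?q (v \<otimes> c \<otimes> w)"
    if "c \<otimes> v \<otimes> inv c \<otimes> inv v \<in> K" "c \<in> carrier G" "v \<in> carrier G" "w \<in> carrier G" for c v w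
    proof -
    have "?q (c \<otimes> v) = ?q (v \<otimes> c)" using that commutator_in_normal_iff[OF K, of c v] by simp
    then have "?q (c \<otimes> v) \<otimes>\<^bsub>G Mod K\<^esub> ?q w = ?q (v \<otimes> c) \<otimes>\<^bsub>G Mod K\<^esub> ?q w" by simp
    then show ?thesis using that by (simp del: mult_FactGroup flip: q.hom_mult)
  qed
  have "x \<otimes> y \<otimes> inv x \<otimes> inv y \<in> centralizer_mod G K Z" if x: "x \<in> H" and y: "y \<in> Y" for x y
    unfolding centralizer_mod_def
  proof (intro CollectI conjI ballI)
    have xc: "x \<in> carrier G" and yc: "y \<in> carrier G" using x y by auto
    then show "x \<otimes> y \<otimes> inv x \<otimes> inv y \<in> carrier G" by simp
    fix z assume z: "z \<in> Z"
    then have zc: "z \<in> carrier G" using Z by blast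
    \<comment> \<open>The correction factors of the conjugation: z x z^-1 = \<open>x1\<close> x and
      z y z^-1 = \<open>y1\<close> y.\<close>
    define x1 where "x1 = inv (x \<otimes> z \<otimes> inv x \<otimes> inv z)"
    define y1 where "y1 = inv (y \<otimes> z \<otimes> inv y \<otimes> inv z)"
    have "x1 \<in> commutator_subgroup G H Z" "y1 \<in> commutator_subgroup G Y Z"
      unfolding x1_def y1_def
      using commutator_in_subgroup[OF x z] commutator_in_subgroup[OF y z]
      by (simp_all add: commutator_subgroup_m_inv H.subset Y.subset Z)
    then have x1: "x1 \<in> carrier G" "\<And>v. v \<in> Y \<Longrightarrow> x1 \<otimes> v \<otimes> inv x1 \<otimes> inv v \<in> K"
      and y1: "y1 \<in> carrier G" "\<And>v. v \<in> H \<Longrightarrow> y1 \<otimes> v \<otimes> inv y1 \<otimes> inv v \<in> K"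
      using comm_carr XZ commutator_subgroup_commute_subset[OF K.is_subgroup H.subset comm_carr(2) YZ]
      by (auto simp: commutator_subgroup_subset_iff[OF K.is_subgroup] centralizer_mod_def)
    define y' where "y' = z \<otimes> y \<otimes> inv z"
    have zx: "z \<otimes> x \<otimes> inv z = x1 \<otimes> x" and zy: "y' = y1 \<otimes> y"
      using xc yc zc by (simp_all add: y'_def x1_def y1_def inv_mult_group m_assoc inv_mult_cancel)
    have y': "y' \<in> Y" "y' \<in> carrier G" using y zc yc by (auto simp: y'_def Y.inv_op_closed2)
    let ?c = "x \<otimes> y \<otimes> inv x \<otimes> inv y"
    have "?q (z \<otimes> ?c \<otimes> inv z) = ?q ((z \<otimes> x \<otimes> inv z) \<otimes> y' \<otimes> inv (z \<otimes> x \<otimes> inv z) \<otimes> inv y')"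
      using xc yc zc by (simp add: y'_def inv_mult_group m_assoc inv_mult_cancel)
    also have "\<dots> = ?q (x1 \<otimes> (x \<otimes> y' \<otimes> inv x) \<otimes> (inv x1 \<otimes> inv y'))"
      unfolding zx using xc x1(1) y' by (simp add: inv_mult_group m_assoc)
    \<comment> \<open>By normality x \<open>y'\<close> x^-1 lies in \<open>Y\<close>, so
      \<open>x1\<close> may pass it modulo \<open>K\<close> and then cancels.\<close>
    also have "\<dots> = ?q ((x \<otimes> y' \<otimes> inv x) \<otimes> x1 \<otimes> (inv x1 \<otimes> inv y'))"
      using xc x1 y' by (intro commuting) (auto simp: Y.inv_op_closed2)
    also have "\<dots> = ?q (x \<otimes> y' \<otimes> inv x \<otimes> inv y')"
      using xc x1(1) y' by (simp add: m_assoc inv_mult_cancel)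
    also have "\<dots> = ?q x \<otimes>\<^bsub>G Mod K\<^esub> ?q (y1 \<otimes> (y \<otimes> inv x \<otimes> inv y) \<otimes> inv y1)"
      unfolding zy using xc yc y1(1) by (simp add: inv_mult_group m_assoc del: mult_FactGroup flip: q.hom_mult)
    \<comment> \<open>Likewise y x^-1 y^-1 lies in \<open>H\<close>, so \<open>y1\<close> passes it
      and cancels.\<close>
    also have "?q (y1 \<otimes> (y \<otimes> inv x \<otimes> inv y) \<otimes> inv y1) = ?q ((y \<otimes> inv x \<otimes> inv y) \<otimes> y1 \<otimes> inv y1)"
      using x yc y1 by (intro commuting) (auto simp: H.inv_op_closed2)
    also have "?q x \<otimes>\<^bsub>G Mod K\<^esub> \<dots> = ?q ?c"
      using xc yc y1(1) by (simp add: m_assoc inv_mult_cancel del: mult_FactGroup flip: q.hom_mult)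
    finally have "?q (z \<otimes> ?c \<otimes> inv z) \<otimes>\<^bsub>G Mod K\<^esub> ?q z = ?q ?c \<otimes>\<^bsub>G Mod K\<^esub> ?q z" by simp
    then have "?q (z \<otimes> ?c) = ?q (?c \<otimes> z)"
      using xc yc zc by (simp add: m_assoc inv_mult_cancel del: mult_FactGroup flip: q.hom_mult)
    then show "?c \<otimes> z \<otimes> inv ?c \<otimes> inv z \<in> K"
      using commutator_in_normal_iff[OF K, of ?c z] xc yc zc by simp
  qed
  then have "commutator_subgroup G H Y \<subseteq> centralizer_mod G K Z"
    unfolding commutator_subgroup_def
    by (intro generate_subgroup_incl[OF _ centralizer_mod_subgroup[OF K Z]]) blast
  then show ?thesis
    by (simp add: commutator_subgroup_subset_iff K.is_subgroup commutator_subgroup_carrier H.subset Y.subset)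
qed

text \<open>Conjugation maps [x, y] to the commutator of the conjugates. Unlike
  \<open>commutator_subgroup_normal\<close>, this covers a second argument smaller than the whole
  group, such as the image of \<open>A\<close> in \<open>G\<close>.\<close>

lemma commutator_subgroup_of_normals:
  assumes H: "H \<lhd> G" and Y: "Y \<lhd> G"
  shows "commutator_subgroup G H Y \<lhd> G"
proof -
  interpret H: normal H G by fact
  interpret Y: normal Y G by fact
  let ?S = "\<Union>x\<in>H. \<Union>y\<in>Y. {x \<otimes> y \<otimes> inv x \<otimes> inv y}"
  have "g \<otimes> s \<otimes> inv g \<in> ?S" if s: "s \<in> ?S" and g: "g \<in> carrier G" for s g
  proof -
    obtain x y where xy: "x \<in> H" "y \<in> Y" "s = x \<otimes> y \<otimes> inv x \<otimes> inv y"
      using s by auto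
    define x' where "x' = g \<otimes> x \<otimes> inv g"
    define y' where "y' = g \<otimes> y \<otimes> inv g"
    have "g \<otimes> s \<otimes> inv g = x' \<otimes> y' \<otimes> inv x' \<otimes> inv y'"
      unfolding x'_def y'_def xy(3) using g xy(1,2)
      by (simp add: inv_mult_group m_assoc inv_mult_cancel)
    moreover have "x' \<in> H" "y' \<in> Y"
      using xy g by (auto simp: x'_def y'_def H.inv_op_closed2 Y.inv_op_closed2)
    ultimately show ?thesis by blast
  qed
  moreover have "?S \<subseteq> carrier G" by auto
  ultimately show ?thesis
    unfolding commutator_subgroup_def by (intro normal_generateI)
qed

end

section \<open>Iterated commutators with the whole group\<close>

definition iterated_commutator :: "('a, 'm) monoid_scheme \<Rightarrow> nat \<Rightarrow> 'a set \<Rightarrow> 'a set"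
  where "iterated_commutator G n = (\<lambda>H. commutator_subgroup G H (carrier G)) ^^ n"

lemma iterated_commutator_0 [simp]: "iterated_commutator G 0 H = H"
  by (simp add: iterated_commutator_def)

lemma iterated_commutator_Suc:
  "iterated_commutator G (Suc n) H = commutator_subgroup G (iterated_commutator G n H) (carrier G)"
  by (simp add: iterated_commutator_def)

lemma iterated_commutator_add:
  "iterated_commutator G (m + n) H = iterated_commutator G m (iterated_commutator G n H)"
  by (simp add: iterated_commutator_def funpow_add)

text \<open>The bound on \<open>k\<close> excludes the index 0, where \<open>lower_central\<close>
  repeats its value at 1 and the shift would be off by one.\<close>

lemma lower_central_add:
  "k \<ge> 1 \<Longrightarrow> lower_central G (n + k) = iterated_commutator G n (lower_central G k)"
  by (induction n) (simp_all add: lower_central_Suc iterated_commutator_Suc)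

context group
begin

lemma iterated_commutator_normal: "H \<lhd> G \<Longrightarrow> iterated_commutator G n H \<lhd> G"
  by (induction n) (simp_all add: iterated_commutator_Suc commutator_subgroup_normal)

lemma iterated_commutator_mono:
  assumes "H \<subseteq> Y" "Y \<subseteq> carrier G"
  shows "iterated_commutator G n H \<subseteq> iterated_commutator G n Y"
proof -
  \<comment> \<open>Monotonicity of one commutator step asks that the larger set lie in the group,
    so the induction carries that along.\<close>
  have "iterated_commutator G n H \<subseteq> iterated_commutator G n Y \<and> iterated_commutator G n Y \<subseteq> carrier G"
    by (induction n)
      (simp_all add: assms iterated_commutator_Suc commutator_subgroup_mono commutator_subgroup_carrier)
  then show ?thesis ..
qed

lemma iterated_commutator_subset:
  assumes H: "H \<lhd> G"
  shows "iterated_commutator G n H \<subseteq> H"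
proof (induction n)
  case (Suc n)
  interpret H: normal H G by fact
  have "x \<otimes> (g \<otimes> inv x \<otimes> inv g) \<in> H" if "x \<in> H" "g \<in> carrier G" for x g
    using that by (intro H.m_closed H.inv_op_closed2) auto
  then have "x \<otimes> g \<otimes> inv x \<otimes> inv g \<in> H" if "x \<in> H" "g \<in> carrier G" for x g
    using that by (simp add: m_assoc)
  then have "iterated_commutator G n H \<subseteq> centralizer_mod G H (carrier G)"
    using Suc by (auto simp: centralizer_mod_def)
  then show ?case
    using Suc H.subset
    by (simp add: iterated_commutator_Suc commutator_subgroup_subset_iff H.is_subgroup subset_trans[OF Suc])
qed simp

text \<open>A Leibniz rule for taking commutators with \<open>G\<close>. In the induction step the three subgroups
  lemma shows that the hypothesis for \<open>Suc m\<close> and \<open>K\<close> gives the one for \<open>m\<close> and the preimage of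
  the centre of \<open>G / K\<close>.\<close>

lemma iterated_commutator_commutator_subset:
  assumes "H \<lhd> G" "Y \<lhd> G" "K \<lhd> G"
    and "\<And>i j. i + j = m \<Longrightarrow>
      commutator_subgroup G (iterated_commutator G i H) (iterated_commutator G j Y) \<subseteq> K"
  shows "iterated_commutator G m (commutator_subgroup G H Y) \<subseteq> K"
  using assms(3,4)
proof (induction m arbitrary: K)
  case 0
  then show ?case by force
next
  case (Suc m)
  let ?K = "centralizer_mod G K (carrier G)"
  have K: "subgroup K G" using Suc.prems normal_imp_subgroup by blast
  have "iterated_commutator G m (commutator_subgroup G H Y) \<subseteq> ?K"
  proof (rule Suc.IH)
    show "?K \<lhd> G" using Suc.prems by (intro centralizer_mod_normal)
    fix i j assume ij: "i + j = m"
    have n: "iterated_commutator G i H \<lhd> G" "iterated_commutator G j Y \<lhd> G"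
      using assms by (simp_all add: iterated_commutator_normal)
    have "commutator_subgroup G (commutator_subgroup G (iterated_commutator G i H)
        (iterated_commutator G j Y)) (carrier G) \<subseteq> K"
      using Suc.prems(2)[of "Suc i" j] Suc.prems(2)[of i "Suc j"] ij
      by (intro three_subgroups[OF Suc.prems(1) n]) (simp_all add: iterated_commutator_Suc)
    then show "commutator_subgroup G (iterated_commutator G i H) (iterated_commutator G j Y) \<subseteq> ?K"
      using n by (simp add: commutator_subgroup_subset_iff[OF K] commutator_subgroup_carrier
          normal_imp_subgroup subgroup.subset)
  qed
  moreover have "iterated_commutator G m (commutator_subgroup G H Y) \<subseteq> carrier G"
    using assms by (simp add: iterated_commutator_normal commutator_subgroup_of_normals
        normal_imp_subgroup subgroup.subset)
  ultimately show ?case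
    by (simp add: iterated_commutator_Suc commutator_subgroup_subset_iff[OF K])
qed

section \<open>Commutators of lower central terms with the derived subgroup\<close>

lemma lower_central_carrier: "lower_central G k \<subseteq> carrier G"
  by (simp add: lower_central_normal normal_imp_subgroup subgroup.subset)

text \<open>Apply the three subgroups lemma to \<open>G\<close>, \<open>G\<close> and the
  \<open>k\<close>-th term L: both [[G, L], G] and [G, [G, L]] lie in the term of index
  \<open>k + 2\<close>, hence so does [[G, G], L], and the arguments are then exchanged.\<close>

lemma commutator_lower_central_2:
  assumes "k \<ge> 1"
  shows "commutator_subgroup G (lower_central G k) (lower_central G 2) \<subseteq> lower_central G (k + 2)"
proof -
  let ?L = "lower_central G"
  have n: "?L (k + 2) \<lhd> G" "carrier G \<lhd> G" "subgroup (?L k) G" for k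
    using lower_central_normal[of "k + 2"] lower_central_normal[of 1]
      normal_imp_subgroup[OF lower_central_normal[of k]] by simp_all
  have e: "commutator_subgroup G (carrier G) (carrier G) = ?L 2"
    by (simp add: numeral_2_eq_2 lower_central_Suc)
  have s: "commutator_subgroup G (?L k) (carrier G) = ?L (Suc k)"
    "commutator_subgroup G (?L (Suc k)) (carrier G) = ?L (k + 2)"
    using assms by (simp_all add: lower_central_Suc)
  have "commutator_subgroup G (carrier G) (?L k) \<subseteq> ?L (Suc k)"
    by (rule commutator_subgroup_commute_subset[OF n(3) lower_central_carrier])
      (simp_all add: s)
  then have a: "commutator_subgroup G (commutator_subgroup G (carrier G) (?L k)) (carrier G)
      \<subseteq> ?L (k + 2)"
    using s(2) commutator_subgroup_mono[of _ "?L (Suc k)" "carrier G" "carrier G"] lower_central_carrier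
    by blast
  have "commutator_subgroup G (carrier G) (commutator_subgroup G (carrier G) (?L k)) \<subseteq> ?L (k + 2)"
    by (rule commutator_subgroup_commute_subset[OF n(3) _ _ a])
      (simp_all add: commutator_subgroup_carrier lower_central_carrier)
  then have "commutator_subgroup G (?L 2) (?L k) \<subseteq> ?L (k + 2)"
    using three_subgroups[OF n(1,2,2) lower_central_carrier a] by (simp only: e)
  then show ?thesis
    by (rule commutator_subgroup_commute_subset[OF n(3) lower_central_carrier lower_central_carrier])
qed

end

section \<open>The action of the group ring\<close>

lemma augmentation_power_0: "augmentation_power B 0 = carrier (integral_group_ring B)"
  by (simp add: augmentation_power_def nat_pow_def ideals_set_def)

text \<open>The new factor stands on the right, so an element x (1 - b) of the product acts by 1 - b
  first and by x afterwards.\<close>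

lemma augmentation_power_Suc:
  "augmentation_power B (Suc n) =
    ideal_prod (integral_group_ring B) (augmentation_power B n) (augmentation_ideal B)"
  by (simp add: augmentation_power_def nat_pow_def ideals_set_def)

lemma augmentation_power_carrier:
  assumes "group B"
  shows "augmentation_power B n \<subseteq> carrier (integral_group_ring B)"
proof (induction n)
  case 0
  then show ?case by (simp add: augmentation_power_0)
next
  case (Suc n)
  interpret R: ring "integral_group_ring B" by (rule integral_group_ring_is_ring[OF assms])
  have "x \<in> carrier (integral_group_ring B)" if "x \<in> augmentation_power B (Suc n)" for x
    using that unfolding augmentation_power_Suc
    by (induction rule: ideal_prod.induct)
      (use Suc in \<open>auto simp: augmentation_ideal_def a_kernel_def' subset_iff\<close>)
  then show ?case by blast
qed

context group_extension
begin

section \<open>Module laws for the group ring action\<close>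

abbreviation act :: "('b \<Rightarrow>\<^sub>0 int) \<Rightarrow> 'a set \<Rightarrow> 'a set"
  where "act \<equiv> group_ring_action A G \<iota> \<pi>"

lemma conj_action_closed:
  "\<lbrakk>b \<in> carrier B; U \<in> carrier (abelianization A)\<rbrakk> \<Longrightarrow>
    conj_action A G \<iota> \<pi> b U \<in> carrier (abelianization A)"
  using conj_action_hom by (auto simp: hom_def)

lemma group_ring_action_closed:
  assumes "Poly_Mapping.keys x \<subseteq> carrier B" "U \<in> carrier (abelianization A)"
  shows "act x U \<in> carrier (abelianization A)"
proof -
  interpret Ab: comm_group "abelianization A" by (rule A.abelianization_comm_group)
  show ?thesis
    unfolding group_ring_action_def
    using assms conj_action_closed by (intro Ab.finprod_closed) auto
qed

text \<open>Additivity applied to x = (x - y) + y. The form with a difference fits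
  \<open>frag_induction\<close>, whose inductive case is a difference.\<close>

lemma group_ring_action_diff:
  assumes x: "Poly_Mapping.keys x \<subseteq> carrier B" and y: "Poly_Mapping.keys y \<subseteq> carrier B"
    and U: "U \<in> carrier (abelianization A)"
  shows "act (x - y) U = act x U \<otimes>\<^bsub>abelianization A\<^esub> inv\<^bsub>abelianization A\<^esub> act y U"
proof -
  interpret Ab: comm_group "abelianization A" by (rule A.abelianization_comm_group)
  have xy: "Poly_Mapping.keys (x - y) \<subseteq> carrier B" using keys_diff[of x y] x y by blast
  have "act x U = act (x - y) U \<otimes>\<^bsub>abelianization A\<^esub> act y U"
    using group_ring_action_add[of "x - y" y U] xy y U by (simp add: integral_group_ring_def)
  then show ?thesis
    using group_ring_action_closed x y xy U by (metis Ab.inv_solve_right)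
qed

lemma group_ring_action_hom:
  assumes "Poly_Mapping.keys x \<subseteq> carrier B"
  shows "act x \<in> hom (abelianization A) (abelianization A)"
proof (rule homI)
  interpret Ab: comm_group "abelianization A" by (rule A.abelianization_comm_group)
  fix U V assume U: "U \<in> carrier (abelianization A)" and V: "V \<in> carrier (abelianization A)"
  show "act x U \<in> carrier (abelianization A)" by (rule group_ring_action_closed[OF assms U])
  let ?c = "conj_action A G \<iota> \<pi>" and ?n = "Poly_Mapping.lookup x"
  have "act x (U \<otimes>\<^bsub>abelianization A\<^esub> V) = (\<Otimes>\<^bsub>abelianization A\<^esub>b\<in>Poly_Mapping.keys x.
      ?c b U [^]\<^bsub>abelianization A\<^esub> ?n b \<otimes>\<^bsub>abelianization A\<^esub> ?c b V [^]\<^bsub>abelianization A\<^esub> ?n b)"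
    unfolding group_ring_action_def
  proof (rule Ab.finprod_cong')
    fix b assume "b \<in> Poly_Mapping.keys x"
    then have b: "b \<in> carrier B" using assms by blast
    then have "?c b (U \<otimes>\<^bsub>abelianization A\<^esub> V) = ?c b U \<otimes>\<^bsub>abelianization A\<^esub> ?c b V"
      using conj_action_hom U V by (auto simp: hom_def)
    then show "?c b (U \<otimes>\<^bsub>abelianization A\<^esub> V) [^]\<^bsub>abelianization A\<^esub> ?n b =
      ?c b U [^]\<^bsub>abelianization A\<^esub> ?n b \<otimes>\<^bsub>abelianization A\<^esub> ?c b V [^]\<^bsub>abelianization A\<^esub> ?n b"
      using b U V by (simp add: Ab.int_pow_distrib conj_action_closed)
  qed (use assms U V conj_action_closed in auto)
  also have "\<dots> = act x U \<otimes>\<^bsub>abelianization A\<^esub> act x V"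
    unfolding group_ring_action_def
    using assms U V conj_action_closed by (intro Ab.finprod_multf) auto
  finally show "act x (U \<otimes>\<^bsub>abelianization A\<^esub> V) = act x U \<otimes>\<^bsub>abelianization A\<^esub> act x V" .
qed

text \<open>The \<open>frag_extend\<close> term is the product of \<open>x\<close> with
  \<open>frag_of b\<close> in the group ring, so this is associativity of the action for a group
  element as right factor. Linearity in \<open>x\<close> reduces it to
  \<open>conj_action_mult\<close>.\<close>

lemma group_ring_action_mult_frag_of:
  assumes x: "Poly_Mapping.keys x \<subseteq> carrier B" and b: "b \<in> carrier B"
    and U: "U \<in> carrier (abelianization A)"
  shows "act (frag_extend (\<lambda>g. frag_of (g \<otimes>\<^bsub>B\<^esub> b)) x) U = act x (conj_action A G \<iota> \<pi> b U)"
proof -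
  let ?r = "frag_extend (\<lambda>g. frag_of (g \<otimes>\<^bsub>B\<^esub> b))"
  have k: "Poly_Mapping.keys (?r z) \<subseteq> carrier B" if "Poly_Mapping.keys z \<subseteq> carrier B" for z
    using that b by (intro order_trans[OF keys_frag_extend] UN_least) auto
  \<comment> \<open>The difference case supplies only the induction predicate for both terms, so the
    support condition is made part of it.\<close>
  have "Poly_Mapping.keys x \<subseteq> carrier B \<and> act (?r x) U = act x (conj_action A G \<iota> \<pi> b U)"
    using x
  proof (induction x rule: frag_induction)
    case zero
    then show ?case by (simp add: group_ring_action_def)
  next
    case (one c)
    then show ?case
      using b U by (simp add: group_ring_action_frag_of conj_action_mult conj_action_closed)
  next
    case (diff x y)
    then show ?case
      using k[of x] k[of y] U b keys_diff[of x y]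
      by (auto simp: frag_extend_diff group_ring_action_diff conj_action_closed)
  qed
  then show ?thesis ..
qed

lemma group_ring_action_mult_diff:
  assumes x: "Poly_Mapping.keys x \<subseteq> carrier B" and b: "b \<in> carrier B" "c \<in> carrier B"
    and U: "U \<in> carrier (abelianization A)"
  shows "act (x \<otimes>\<^bsub>integral_group_ring B\<^esub> (frag_of b - frag_of c)) U =
    act x (conj_action A G \<iota> \<pi> b U \<otimes>\<^bsub>abelianization A\<^esub> inv\<^bsub>abelianization A\<^esub> conj_action A G \<iota> \<pi> c U)"
proof -
  interpret Ab: comm_group "abelianization A" by (rule A.abelianization_comm_group)
  interpret h: group_hom "abelianization A" "abelianization A" "act x"
    using group_ring_action_hom[OF x] by unfold_locales
  have k: "Poly_Mapping.keys (frag_extend (\<lambda>g. frag_of (g \<otimes>\<^bsub>B\<^esub> b)) x) \<subseteq> carrier B"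
    if "b \<in> carrier B" for b
    using that x by (intro order_trans[OF keys_frag_extend] UN_least) auto
  show ?thesis
    using x b U k[OF b(1)] k[OF b(2)]
    by (simp add: integral_group_ring_def frag_extend_diff frag_extend_fun_diff
        group_ring_action_diff group_ring_action_mult_frag_of conj_action_closed)
qed

text \<open>The preimage in \<open>A\<close> of the part of the abelianization killed by the
  \<open>m\<close>-th power of the augmentation ideal. Taking elements of \<open>A\<close> instead
  of cosets lets commutators in \<open>G\<close> act on this filtration directly.\<close>

definition annihilated :: "nat \<Rightarrow> 'a set"
  where "annihilated m =
    {a \<in> carrier A. \<forall>x\<in>augmentation_power B m.
      act x (lower_central A 2 #>\<^bsub>A\<^esub> a) = \<one>\<^bsub>abelianization A\<^esub>}"

text \<open>An intersection of kernels: each \<open>act x\<close> is an endomorphism of the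
  abelianization, composed with the quotient map.\<close>

lemma annihilated_subgroup: "subgroup (annihilated m) A"
proof -
  interpret D: normal "lower_central A 2" A by (rule A.lower_central_normal)
  interpret Ab: comm_group "abelianization A" by (rule A.abelianization_comm_group)
  interpret q: group_hom A "abelianization A" "\<lambda>a. lower_central A 2 #>\<^bsub>A\<^esub> a"
    using D.r_coset_hom_Mod by unfold_locales (simp add: abelianization_def)
  have h: "group_hom (abelianization A) (abelianization A) (act x)"
    if "x \<in> augmentation_power B m" for x
  proof -
    have "Poly_Mapping.keys x \<subseteq> carrier B"
      using that augmentation_power_carrier[OF B.group_axioms] by (auto simp: integral_group_ring_def)
    then show ?thesis using group_ring_action_hom by unfold_locales
  qed
  show ?thesis
  proof (rule A.subgroupI)
    show "annihilated m \<subseteq> carrier A" by (auto simp: annihilated_def)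
    have "\<one>\<^bsub>A\<^esub> \<in> annihilated m"
      using group_hom.hom_one[OF h] by (simp add: annihilated_def del: q.hom_one flip: q.hom_one)
    then show "annihilated m \<noteq> {}" by blast
  next
    fix a assume "a \<in> annihilated m"
    then show "inv\<^bsub>A\<^esub> a \<in> annihilated m"
      using group_hom.hom_inv[OF h] by (simp add: annihilated_def)
  next
    fix a b assume "a \<in> annihilated m" "b \<in> annihilated m"
    then show "a \<otimes>\<^bsub>A\<^esub> b \<in> annihilated m"
      using group_hom.hom_mult[OF h] by (simp add: annihilated_def del: D.rcos_sum)
  qed
qed

lemma annihilated_0: "annihilated 0 \<subseteq> lower_central A 2"
proof
  interpret D: normal "lower_central A 2" A by (rule A.lower_central_normal)
  fix a assume a: "a \<in> annihilated 0"
  then have ac: "a \<in> carrier A" by (simp add: annihilated_def)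
  have "frag_of \<one>\<^bsub>B\<^esub> \<in> augmentation_power B 0"
    by (simp add: augmentation_power_0 integral_group_ring_def)
  \<comment> \<open>The zeroth power is the whole ring, so its unit must kill the coset. The unit of
    \<open>B\<close> is written as the image of the unit of \<open>G\<close> so that
    \<open>conj_action_coset\<close> applies to this lift.\<close>
  then have "act (frag_of (\<pi> \<one>\<^bsub>G\<^esub>)) (lower_central A 2 #>\<^bsub>A\<^esub> a) = lower_central A 2"
    using a by (simp add: annihilated_def abelianization_def)
  moreover have "conj_by \<one>\<^bsub>G\<^esub> a = a"
    using ac by (intro inj) (simp_all add: conj_by)
  ultimately have "lower_central A 2 #>\<^bsub>A\<^esub> a = lower_central A 2"
    using ac conj_action_coset[of "\<one>\<^bsub>G\<^esub>" a]
    by (subst (asm) group_ring_action_frag_of) (auto simp: abelianization_def carrier_FactGroup)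
  then show "a \<in> lower_central A 2"
    using A.rcos_self[OF ac D.is_subgroup] by simp
qed

text \<open>The commutator of \<iota> a with g comes from an element of \<open>A\<close> whose class
  is 1 - \<pi> g applied to the class of a. As x (1 - \<pi> g) lies in the power of exponent
  \<open>Suc m\<close> for x in the \<open>m\<close>-th power, x kills this class.\<close>

lemma annihilated_commutator:
  "commutator_subgroup G (\<iota> ` annihilated (Suc m)) (carrier G) \<subseteq> \<iota> ` annihilated m"
proof -
  interpret D: normal "lower_central A 2" A by (rule A.lower_central_normal)
  interpret Ab: comm_group "abelianization A" by (rule A.abelianization_comm_group)
  interpret q: group_hom A "abelianization A" "\<lambda>a. lower_central A 2 #>\<^bsub>A\<^esub> a"
    using D.r_coset_hom_Mod by unfold_locales (simp add: abelianization_def)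
  let ?q = "\<lambda>a. lower_central A 2 #>\<^bsub>A\<^esub> a"
  have s: "subgroup (\<iota> ` annihilated m) G"
    by (rule \<iota>.subgroup_img_is_subgroup[OF annihilated_subgroup])
  have "\<iota> a \<otimes>\<^bsub>G\<^esub> g \<otimes>\<^bsub>G\<^esub> inv\<^bsub>G\<^esub> \<iota> a \<otimes>\<^bsub>G\<^esub> inv\<^bsub>G\<^esub> g \<in> \<iota> ` annihilated m"
    if a: "a \<in> annihilated (Suc m)" and g: "g \<in> carrier G" for a g
  proof -
    have ac: "a \<in> carrier A" using a by (simp add: annihilated_def)
    have one: "conj_by \<one>\<^bsub>G\<^esub> a = a"
      using ac by (intro inj) (simp_all add: conj_by)
    define c where "c = a \<otimes>\<^bsub>A\<^esub> inv\<^bsub>A\<^esub> conj_by g a"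
    have cc: "c \<in> carrier A" using ac g by (simp add: c_def conj_by)
    have "\<iota> c = \<iota> a \<otimes>\<^bsub>G\<^esub> g \<otimes>\<^bsub>G\<^esub> inv\<^bsub>G\<^esub> \<iota> a \<otimes>\<^bsub>G\<^esub> inv\<^bsub>G\<^esub> g"
      using ac g by (simp add: c_def conj_by G.inv_mult_group G.m_assoc)
    moreover have "act x (?q c) = \<one>\<^bsub>abelianization A\<^esub>" if x: "x \<in> augmentation_power B m" for x
    proof -
      have kx: "Poly_Mapping.keys x \<subseteq> carrier B"
        using x augmentation_power_carrier[OF B.group_axioms] by (auto simp: integral_group_ring_def)
      have "?q c = conj_action A G \<iota> \<pi> (\<pi> \<one>\<^bsub>G\<^esub>) (?q a) \<otimes>\<^bsub>abelianization A\<^esub>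
          inv\<^bsub>abelianization A\<^esub> conj_action A G \<iota> \<pi> (\<pi> g) (?q a)"
        using ac g one by (simp add: c_def conj_action_coset conj_by del: \<pi>.hom_one D.rcos_sum)
      then have "act x (?q c) =
          act (x \<otimes>\<^bsub>integral_group_ring B\<^esub> (frag_of (\<pi> \<one>\<^bsub>G\<^esub>) - frag_of (\<pi> g))) (?q a)"
        using group_ring_action_mult_diff[OF kx, of "\<pi> \<one>\<^bsub>G\<^esub>" "\<pi> g" "?q a"] ac g
        by (simp del: \<pi>.hom_one)
      moreover have "x \<otimes>\<^bsub>integral_group_ring B\<^esub> (frag_of (\<pi> \<one>\<^bsub>G\<^esub>) - frag_of (\<pi> g))
          \<in> augmentation_power B (Suc m)"
        unfolding augmentation_power_Suc
        using x g by (intro ideal_prod.prod frag_of_diff_in_augmentation_ideal) auto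
      ultimately show ?thesis using a by (simp add: annihilated_def)
    qed
    ultimately show ?thesis using cc by (force simp: annihilated_def)
  qed
  then show ?thesis
    using s
    by (subst G.commutator_subgroup_subset_iff) (auto simp: centralizer_mod_def annihilated_def)
qed

text \<open>Each commutator with \<open>G\<close> lowers the index of the filtration by one. The
  index \<open>m\<close> is general because the induction hypothesis is used at
  \<open>Suc m\<close>.\<close>

lemma iterated_commutator_annihilated:
  "annihilated (n + m) = carrier A \<Longrightarrow> iterated_commutator G n (\<iota> ` carrier A) \<subseteq> \<iota> ` annihilated m"
proof (induction n arbitrary: m)
  case 0
  then show ?case by simp
next
  case (Suc n)
  have "iterated_commutator G n (\<iota> ` carrier A) \<subseteq> \<iota> ` annihilated (Suc m)"
    using Suc by simp
  moreover have "\<iota> ` annihilated (Suc m) \<subseteq> carrier G" by (auto simp: annihilated_def)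
  ultimately show ?case
    using G.commutator_subgroup_mono[OF _ order_refl _ order_refl] annihilated_commutator[of m]
    unfolding iterated_commutator_Suc by blast
qed

lemma iterated_commutator_lower_central_2:
  assumes "ideal_times_abelianization A G \<iota> \<pi> (augmentation_power B N) = {\<one>\<^bsub>abelianization A\<^esub>}"
  shows "iterated_commutator G N (\<iota> ` carrier A) \<subseteq> \<iota> ` lower_central A 2"
proof -
  have "act x (lower_central A 2 #>\<^bsub>A\<^esub> a) = \<one>\<^bsub>abelianization A\<^esub>"
    if "x \<in> augmentation_power B N" "a \<in> carrier A" for x a
  proof -
    have "act x (lower_central A 2 #>\<^bsub>A\<^esub> a)
        \<in> ideal_times_abelianization A G \<iota> \<pi> (augmentation_power B N)"
      unfolding ideal_times_abelianization_def using that
      by (intro generate.incl) (auto simp: abelianization_def carrier_FactGroup)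
    then show ?thesis using assms by simp
  qed
  \<comment> \<open>Written as a sum so that the filtration can descend \<open>N\<close> steps, from
    all of \<open>A\<close> to index 0.\<close>
  then have "annihilated (N + 0) = carrier A" by (auto simp: annihilated_def)
  then show ?thesis
    using iterated_commutator_annihilated annihilated_0 by (meson image_mono order_trans)
qed

section \<open>Comparison of the lower central series\<close>

lemma image_normal:
  assumes "H \<lhd> A" "\<And>g. g \<in> carrier G \<Longrightarrow> conj_by g ` H \<subseteq> H"
  shows "\<iota> ` H \<lhd> G"
proof -
  interpret H: normal H A by fact
  have "g \<otimes>\<^bsub>G\<^esub> \<iota> a \<otimes>\<^bsub>G\<^esub> inv\<^bsub>G\<^esub> g \<in> \<iota> ` H" if "g \<in> carrier G" "a \<in> H" for g a
    using conj_by(2)[OF that(1), of a] assms(2)[OF that(1)] that(2)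
    by (metis H.mem_carrier imageI subsetD)
  then show ?thesis
    using \<iota>.subgroup_img_is_subgroup[OF H.is_subgroup] by (auto simp: G.normal_inv_iff)
qed

lemma image_carrier_normal: "\<iota> ` carrier A \<lhd> G"
  using A.lower_central_normal[of 1] by (intro image_normal) (auto simp: conj_by)

text \<open>Homomorphisms preserve commutator subgroups, so the lower central series of
  \<open>A\<close> is computed inside \<open>G\<close>, where the Leibniz rule is available.\<close>

lemma image_lower_central_Suc:
  assumes "k \<ge> 1"
  shows "\<iota> ` lower_central A (Suc k) = commutator_subgroup G (\<iota> ` lower_central A k) (\<iota> ` carrier A)"
  using assms \<iota>.commutator_subgroup_img[OF A.lower_central_carrier order_refl]
  by (simp add: lower_central_Suc)

lemma image_lower_central_normal: "k \<ge> 1 \<Longrightarrow> \<iota> ` lower_central A k \<lhd> G"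
proof (induction k rule: dec_induct)
  case base
  show ?case by (simp add: image_carrier_normal)
next
  case (step k)
  then show ?case
    by (simp add: image_lower_central_Suc G.commutator_subgroup_of_normals image_carrier_normal)
qed

text \<open>Induction on \<open>k\<close>: if \<open>M\<close> commutators suffice for
  \<open>k\<close>, then \<open>M + N\<close> suffice for \<open>Suc k\<close>.\<close>

lemma iterated_commutator_lower_central_Suc:
  assumes N: "iterated_commutator G N (\<iota> ` carrier A) \<subseteq> \<iota> ` lower_central A 2" and k: "k \<ge> 1"
  shows "\<exists>M. iterated_commutator G M (\<iota> ` lower_central A k) \<subseteq> \<iota> ` lower_central A (Suc k)"
  using k
proof (induction k rule: dec_induct)
  case base
  show ?case using N by (auto simp: numeral_2_eq_2)
next
  case (step k)
  let ?L = "\<lambda>k. \<iota> ` lower_central A k"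
  obtain M where M: "iterated_commutator G M (?L k) \<subseteq> ?L (Suc k)" using step by blast
  have nL: "?L k \<lhd> G" "?L (Suc k) \<lhd> G" "?L (k + 2) \<lhd> G" "?L 2 \<lhd> G"
    using step(1) by (simp_all add: image_lower_central_normal)
  have c: "?L j \<subseteq> carrier G" for j using A.lower_central_carrier by (auto simp: subset_iff)
  have nA: "\<iota> ` carrier A \<lhd> G" by (rule image_carrier_normal)
  \<comment> \<open>Once the iterated commutators enter a normal subgroup, they stay in it.\<close>
  have iter: "iterated_commutator G i H \<subseteq> K"
    if "H \<lhd> G" "K \<lhd> G" "m \<le> i" "iterated_commutator G m H \<subseteq> K" for i m H K
  proof -
    have "iterated_commutator G i H = iterated_commutator G (i - m) (iterated_commutator G m H)"
      using that(3) by (simp flip: iterated_commutator_add)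
    also have "\<dots> \<subseteq> iterated_commutator G (i - m) K"
      using that by (intro G.iterated_commutator_mono) (auto dest: normal_imp_subgroup subgroup.subset)
    also have "\<dots> \<subseteq> K" using that(2) by (rule G.iterated_commutator_subset)
    finally show ?thesis .
  qed
  \<comment> \<open>If \<open>i + j = M + N\<close>, then \<open>M \<le> i\<close> or
    \<open>N \<le> j\<close>. In the first case the left factor has dropped to index
    \<open>Suc k\<close>; in the second the right factor has dropped to index 2, and
    \<open>commutator_lower_central_2\<close> applies.\<close>
  have "iterated_commutator G (M + N) (commutator_subgroup G (?L k) (\<iota> ` carrier A)) \<subseteq> ?L (k + 2)"
  proof (rule G.iterated_commutator_commutator_subset[OF nL(1) nA nL(3)])
    fix i j assume ij: "i + j = M + N"
    show "commutator_subgroup G (iterated_commutator G i (?L k))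
        (iterated_commutator G j (\<iota> ` carrier A)) \<subseteq> ?L (k + 2)"
    proof (cases "M \<le> i")
      case True
      have "commutator_subgroup G (iterated_commutator G i (?L k)) (iterated_commutator G j (\<iota> ` carrier A))
          \<subseteq> commutator_subgroup G (?L (Suc k)) (\<iota> ` carrier A)"
        using iter[OF nL(1,2) True M] G.iterated_commutator_subset[OF nA] c[of "Suc k"] c[of 1]
        by (intro G.commutator_subgroup_mono) simp_all
      then show ?thesis using step(1) by (simp add: image_lower_central_Suc)
    next
      case False
      then have "N \<le> j" using ij by simp
      have "commutator_subgroup G (iterated_commutator G i (?L k)) (iterated_commutator G j (\<iota> ` carrier A))
          \<subseteq> commutator_subgroup G (?L k) (?L 2)"
        using iter[OF nA nL(4) \<open>N \<le> j\<close> N] G.iterated_commutator_subset[OF nL(1)] c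
        by (intro G.commutator_subgroup_mono) simp_all
      also have "\<dots> \<subseteq> ?L (k + 2)"
        using \<iota>.commutator_subgroup_img[of "lower_central A k" "lower_central A 2"]
          A.commutator_lower_central_2[OF step(1)] A.lower_central_carrier
        by (simp add: image_mono)
      finally show ?thesis .
    qed
  qed
  then show ?case using step(1) by (auto simp: image_lower_central_Suc)
qed

lemma iterated_commutator_lower_central:
  assumes N: "iterated_commutator G N (\<iota> ` carrier A) \<subseteq> \<iota> ` lower_central A 2" and k: "k \<ge> 1"
  shows "\<exists>M. iterated_commutator G M (\<iota> ` carrier A) \<subseteq> \<iota> ` lower_central A k"
  using k
proof (induction k rule: dec_induct)
  case base
  show ?case by (auto intro!: exI[of _ 0])
next
  case (step k)
  obtain M where M: "iterated_commutator G M (\<iota> ` carrier A) \<subseteq> \<iota> ` lower_central A k"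
    using step by blast
  obtain M' where M': "iterated_commutator G M' (\<iota> ` lower_central A k) \<subseteq> \<iota> ` lower_central A (Suc k)"
    using iterated_commutator_lower_central_Suc[OF N step(1)] by blast
  have "iterated_commutator G (M' + M) (\<iota> ` carrier A) \<subseteq> iterated_commutator G M' (\<iota> ` lower_central A k)"
    unfolding iterated_commutator_add using M A.lower_central_carrier
    by (intro G.iterated_commutator_mono) (auto simp: subset_iff)
  then show ?case using M' by blast
qed

end

section \<open>Residual nilpotence of the extension\<close>

theorem theorem3p2:
  fixes A :: "('a, 'm) monoid_scheme" and G :: "('g, 'n) monoid_scheme"
    and B :: "('b, 'k) monoid_scheme"
    and \<iota> :: "'a \<Rightarrow> 'g" and \<pi> :: "'g \<Rightarrow> 'b" and N :: nat
  assumes "group_extension A G B \<iota> \<pi>"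
    and "residually_nilpotent A"
    and "nilpotent_group B"
    and "N \<ge> 1"
    and "ideal_times_abelianization A G \<iota> \<pi> (augmentation_power B N) = {\<one>\<^bsub>abelianization A\<^esub>}"
  shows "residually_nilpotent G"
proof -
  interpret group_extension A G B \<iota> \<pi> by fact
  obtain s where s: "s \<ge> 2" "lower_central B s = {\<one>\<^bsub>B\<^esub>}"
    using assms(3) by (auto simp: nilpotent_group_def)
  \<comment> \<open>Surjectivity of \<pi> transfers nilpotency of \<open>B\<close>: the
    \<open>s\<close>-th term of \<open>G\<close> dies in \<open>B\<close>, hence by exactness lies
    in the image of \<open>A\<close>.\<close>
  have "lower_central B s = \<pi> ` lower_central G s"
    using projection s(1) by (intro \<pi>.lower_central_img) (auto simp: epi_def)
  then have "\<pi> g = \<one>\<^bsub>B\<^esub>" if "g \<in> lower_central G s" for g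
    using s(2) that by blast
  then have sA: "lower_central G s \<subseteq> \<iota> ` carrier A"
    using G.lower_central_carrier[of s] unfolding exact kernel_def by blast
  have N: "iterated_commutator G N (\<iota> ` carrier A) \<subseteq> \<iota> ` lower_central A 2"
    by (rule iterated_commutator_lower_central_2[OF assms(5)])
  have "g = \<one>\<^bsub>G\<^esub>" if g: "g \<in> lower_central_omega G" for g
  proof -
    have gk: "g \<in> \<iota> ` lower_central A k" if k: "k \<ge> 1" for k
    proof -
      obtain M where M: "iterated_commutator G M (\<iota> ` carrier A) \<subseteq> \<iota> ` lower_central A k"
        using iterated_commutator_lower_central[OF N k] by blast
      have "lower_central G (M + s) = iterated_commutator G M (lower_central G s)"
        using s(1) by (intro lower_central_add) simp
      also have "\<dots> \<subseteq> iterated_commutator G M (\<iota> ` carrier A)"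
        using sA by (intro G.iterated_commutator_mono) auto
      finally have "lower_central G (M + s) \<subseteq> \<iota> ` lower_central A k" using M by blast
      moreover have "g \<in> lower_central G (M + s)"
        using g s(1) by (simp add: lower_central_omega_def)
      ultimately show ?thesis by blast
    qed
    obtain a where a: "a \<in> carrier A" "g = \<iota> a" using gk[of 1] by auto
    have "a \<in> lower_central A k" if "k \<ge> 1" for k
    proof -
      \<comment> \<open>The preimage obtained may vary with \<open>k\<close>; injectivity of \<iota>
        identifies all of them with the fixed \<open>a\<close>.\<close>
      obtain a' where "a' \<in> lower_central A k" "\<iota> a' = \<iota> a" using gk[OF \<open>k \<ge> 1\<close>] a(2) by auto
      then show ?thesis using inj[of a' a] a(1) A.lower_central_carrier[of k] by auto
    qed
    then have "a \<in> lower_central_omega A" by (simp add: lower_central_omega_def)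
    then have "a = \<one>\<^bsub>A\<^esub>" using assms(2) by (simp add: A.residually_nilpotent_iff)
    then show ?thesis using a by simp
  qed
  moreover have "\<one>\<^bsub>G\<^esub> \<in> lower_central_omega G"
    using subgroup.one_closed[OF normal_imp_subgroup[OF G.lower_central_normal]]
    by (simp add: lower_central_omega_def)
  ultimately have "lower_central_omega G = {\<one>\<^bsub>G\<^esub>}" by blast
  then show ?thesis by (simp add: G.residually_nilpotent_iff)
qed

end
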